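(* The (non-constant) stationary solutions $\tau=\tau(s)>0$ of $$\tau_t = D_s\big(\tau^{-1/2}-\tau^{3/2}+D_s^2(\tau^{-1/2})\big)$$ are given by the integral formula $$\int\frac{du}{\sqrt{C+2Au-u^2-u^{-2}}}=s+k,$$ where $\tau(s)=u(s)^{-2}$ and $A,k,C$ are appropriate real constants. When $A=0$ the solutions are given explicitly by $$\tau(s)=\frac{2}{C\pm\sqrt{C^2-4}\,\sin(2(s+k))},$$ with real constants $k$ and $C\ge 2$.
   Context: $D_s=d/ds$. A stationary solution is a smooth time-independent positive function $\tau(s)$ satisfying $D_s\big(\tau^{-1/2}-\tau^{3/2}+D_s^2(\tau^{-1/2})\big)=0$. With $u=\tau^{-1/2}>0$, the constant $A$ is the constant value of $u-u^{-3}+D_s^2u$. The integral formula is understood as the general solution of the separable equation $D_su=\sqrt{C+2Au-u^2-u^{-2}}$ (with either sign of the square root), on intervals where the radicand is positive. *)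

theory Defs
  imports "HOL-Analysis.Analysis"
begin

text \<open>Functions of the parameter \<open>s\<close> are total functions on the reals; only their values on an
  open interval \<open>I\<close> matter, and \<open>deriv\<close> at a point of an open set only depends on them.\<close>

definition smooth_on :: "real set \<Rightarrow> (real \<Rightarrow> real) \<Rightarrow> bool" where
  "smooth_on I f \<longleftrightarrow> (\<forall>n. \<forall>s\<in>I. (deriv ^^ n) f differentiable (at s))"

definition u_of :: "(real \<Rightarrow> real) \<Rightarrow> real \<Rightarrow> real" where
  "u_of \<tau> s = \<tau> s powr (- 1 / 2)"

definition flux :: "(real \<Rightarrow> real) \<Rightarrow> real \<Rightarrow> real" where
  "flux \<tau> s = \<tau> s powr (- 1 / 2) - \<tau> s powr (3 / 2)
     + deriv (deriv (\<lambda>r. \<tau> r powr (- 1 / 2))) s"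

text \<open>In terms of \<open>u = u_of \<tau>\<close>, the flux is \<open>u - u\<^sup>-\<^sup>3 + D\<^sub>s\<^sup>2 u\<close>; its constant value along a
  stationary solution is the constant \<open>A\<close> below.\<close>

definition stationary_on :: "real set \<Rightarrow> (real \<Rightarrow> real) \<Rightarrow> bool" where
  "stationary_on I \<tau> \<longleftrightarrow> smooth_on I \<tau> \<and> (\<forall>s\<in>I. \<tau> s > 0) \<and>
     (\<forall>s\<in>I. (flux \<tau> has_real_derivative 0) (at s))"

definition radicand :: "real \<Rightarrow> real \<Rightarrow> real \<Rightarrow> real" where
  "radicand A C v = C + 2 * A * v - v\<^sup>2 - 1 / v\<^sup>2"

text \<open>The indefinite integral is taken on an interval \<open>U\<close> of positive numbers where the radicand
  is positive, as a definite integral from some base point \<open>c\<close> of \<open>U\<close> (moving \<open>c\<close> changes \<open>k\<close>).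
  The factor \<open>\<sigma>\<close> is the sign of the square root.\<close>

definition integral_formula :: "real \<Rightarrow> real \<Rightarrow> real \<Rightarrow> (real \<Rightarrow> real) \<Rightarrow> real set \<Rightarrow> bool" where
  "integral_formula A C k \<tau> J \<longleftrightarrow>
     (\<exists>U c \<sigma>. open U \<and> is_interval U \<and> U \<subseteq> {0<..} \<and> (\<forall>v\<in>U. radicand A C v > 0) \<and>
        c \<in> U \<and> \<sigma> \<in> {1, - 1} \<and>
        (\<forall>s\<in>J. u_of \<tau> s \<in> U \<and>
           (LBINT v=c..u_of \<tau> s. 1 / (\<sigma> * sqrt (radicand A C v))) = s + k))"

text \<open>A non-constant solution may pass through turning points, where the radicand vanishes and
  the sign of \<open>D\<^sub>s u\<close> changes. The formula then describes it on every interval between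
  turning points (with \<open>k\<close> and the sign depending on that interval, but not \<open>A\<close> and \<open>C\<close>); the
  first conjunct says that the turning points are isolated, so that these intervals exhaust \<open>I\<close>
  up to isolated points.\<close>

definition given_by_integral :: "real \<Rightarrow> real \<Rightarrow> (real \<Rightarrow> real) \<Rightarrow> real set \<Rightarrow> bool" where
  "given_by_integral A C \<tau> I \<longleftrightarrow>
     (\<forall>s\<in>I. \<forall>\<^sub>F r in at s. radicand A C (u_of \<tau> r) > 0) \<and>
     (\<forall>J. open J \<and> is_interval J \<and> J \<noteq> {} \<and> J \<subseteq> I \<and> (\<forall>s\<in>J. radicand A C (u_of \<tau> s) > 0)
        \<longrightarrow> (\<exists>k. integral_formula A C k \<tau> J))"

definition explicit_form :: "real \<Rightarrow> real \<Rightarrow> (real \<Rightarrow> real) \<Rightarrow> real set \<Rightarrow> bool" where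
  "explicit_form C k \<tau> I \<longleftrightarrow>
     (\<exists>\<sigma>\<in>{1, - 1}. \<forall>s\<in>I. \<tau> s = 2 / (C + \<sigma> * sqrt (C\<^sup>2 - 4) * sin (2 * (s + k))))"

end

theory Submission
  imports Defs
begin

text \<open>Constancy of the flux is the equation \<open>u'' = A - u + u\<^sup>-\<^sup>3\<close>, whose first integral is
  \<open>u'\<^sup>2 = radicand A C u\<close>; separating variables gives the integral formula on every interval without
  zeros of \<open>u'\<close>, and conversely the inverse function theorem recovers \<open>u' = \<plusminus>sqrt (radicand A C u)\<close>.
  At a zero of \<open>u'\<close> either \<open>u'' \<noteq> 0\<close>, so that the zero is isolated, or the radicand has a double root
  at the value of \<open>u\<close>; being strictly concave it is then negative elsewhere, which makes \<open>u\<close> constant.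
  For \<open>A = 0\<close> the function \<open>y = 1 / \<tau> = u\<^sup>2\<close> solves the harmonic oscillator equation
  \<open>y'' = 2 * C - 4 * y\<close>, with energy \<open>y'\<^sup>2 + (2 * y - C)\<^sup>2 = C\<^sup>2 - 4\<close>.\<close>

section \<open>Primitives on open intervals and the derivative of the radicand\<close>

text \<open>The bounds of \<open>LBINT\<close> are extended reals; naming the integral gives a
  function of a real upper bound that can be differentiated and composed.\<close>

definition interval_primitive :: "real \<Rightarrow> (real \<Rightarrow> real) \<Rightarrow> real \<Rightarrow> real" where
  "interval_primitive c f x = (LBINT v=c..x. f v)"

text \<open>The fundamental theorem is available on a compact interval. Openness of \<open>U\<close>
  leaves room to enlarge the segment between \<open>c\<close> and \<open>x\<close> inside
  \<open>U\<close>, so that \<open>x\<close> becomes an interior point and the derivative is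
  two-sided.\<close>

lemma has_real_derivative_interval_primitive:
  fixes U :: "real set"
  assumes U: "open U" "is_interval U" and "c \<in> U" "x \<in> U" and cont: "continuous_on U f"
  shows "(interval_primitive c f has_real_derivative f x) (at x)"
proof -
  define a where "a = min c x"
  define b where "b = max c x"
  have "a \<in> U" "b \<in> U"
    using assms by (auto simp: a_def b_def min_def max_def)
  obtain e where e: "e > 0" "ball a e \<subseteq> U"
    using U(1) \<open>a \<in> U\<close> open_contains_ball by blast
  obtain e' where e': "e' > 0" "ball b e' \<subseteq> U"
    using U(1) \<open>b \<in> U\<close> open_contains_ball by blast
  have in_U: "a - e / 2 \<in> U" "b + e' / 2 \<in> U"
    using e e' by (auto simp: dist_real_def subset_iff)
  have sub: "{a - e / 2..b + e' / 2} \<subseteq> U"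
    using U(2) in_U unfolding is_interval_1 by (meson atLeastAtMost_iff subsetI)
  have le: "a - e / 2 < x" "x < b + e' / 2" "a - e / 2 \<le> c" "c \<le> b + e' / 2"
    using e e' by (auto simp: a_def b_def)
  have "((\<lambda>u. LBINT y=c..u. f y) has_vector_derivative f x) (at x within {a - e / 2..b + e' / 2})"
    by (rule interval_integral_FTC2) (use le continuous_on_subset[OF cont sub] in auto)
  then show ?thesis
    using le at_within_Icc_at[of "a - e / 2" x "b + e' / 2"]
    by (simp add: has_real_derivative_iff_has_vector_derivative interval_primitive_def[abs_def])
qed

text \<open>Half the derivative of the radicand in \<open>u\<close> is
  \<open>A - u + 1 / u ^ 3\<close>, which is the right-hand side of the equation for
  \<open>u''\<close>. This is what links the first-order and the second-order equation, in both
  directions.\<close>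

lemma radicand_has_derivative:
  assumes "(u has_real_derivative p) (at s)" "u s > 0"
  shows "((\<lambda>r. radicand A C (u r)) has_real_derivative
    2 * (A - u s + 1 / u s ^ 3) * p) (at s)"
proof -
  have "((\<lambda>r. radicand A C (u r)) has_real_derivative
      0 + 2 * A * p - 2 * u s * p - (0 * (u s)\<^sup>2 - 1 * (2 * u s * p)) / ((u s)\<^sup>2 * (u s)\<^sup>2)) (at s)"
    unfolding radicand_def using assms
    by (intro DERIV_diff DERIV_add DERIV_cmult DERIV_divide DERIV_const)
       (auto intro!: derivative_eq_intros)
  also have "0 + 2 * A * p - 2 * u s * p - (0 * (u s)\<^sup>2 - 1 * (2 * u s * p)) / ((u s)\<^sup>2 * (u s)\<^sup>2) =
      2 * (A - u s + 1 / u s ^ 3) * p"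
    using assms(2) by (simp add: field_simps power2_eq_square power3_eq_cube)
  finally show ?thesis .
qed

lemma continuous_on_radicand: "U \<subseteq> {0<..} \<Longrightarrow> continuous_on U (radicand A C)"
  unfolding radicand_def[abs_def] by (intro continuous_intros) auto

section \<open>Passing between \<open>\<tau>\<close> and \<open>u\<close>\<close>

lemma u_of_pos: "\<tau> s > 0 \<Longrightarrow> u_of \<tau> s > 0"
  by (simp add: u_of_def)

lemma \<tau>_eq_u_of: "\<tau> s > 0 \<Longrightarrow> \<tau> s = 1 / u_of \<tau> s ^ 2"
  by (simp add: u_of_def powr_realpow[symmetric] powr_powr powr_minus divide_simps)

lemma powr_three_halves: "\<tau> s > 0 \<Longrightarrow> \<tau> s powr (3 / 2) = 1 / u_of \<tau> s ^ 3"
  by (simp add: u_of_def powr_realpow[symmetric] powr_powr powr_minus divide_simps)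

lemma u_of_eq:
  assumes "u > 0" "\<tau> s = 1 / u ^ 2"
  shows "u_of \<tau> s = u"
proof -
  have "\<tau> s = u powr (- 2)"
    using assms by (simp add: powr_minus_divide)
  then show ?thesis
    using assms(1) by (simp add: u_of_def powr_powr)
qed

section \<open>From the integral formula to differential equations\<close>

text \<open>The formula says that \<open>u\<close> is a right inverse of the shifted primitive
  \<open>G\<close>. As \<open>G\<close> is strictly monotone on \<open>U\<close>, \<open>u\<close>
  inverts it locally, and its derivative is the reciprocal of the integrand. Even the continuity of
  \<open>u\<close> is a conclusion here.\<close>

lemma u_of_derivative_of_integral_formula:
  assumes J: "open J" and int: "integral_formula A C k \<tau> J"
  obtains \<sigma> where "\<sigma> \<in> {1, -1}"
    and "\<And>s. s \<in> J \<Longrightarrow> radicand A C (u_of \<tau> s) > 0"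
    and "\<And>s. s \<in> J \<Longrightarrow>
      (u_of \<tau> has_real_derivative \<sigma> * sqrt (radicand A C (u_of \<tau> s))) (at s)"
proof -
  obtain U c \<sigma> where U: "open U" "is_interval U" "U \<subseteq> {0<..}" "\<And>v. v \<in> U \<Longrightarrow> radicand A C v > 0"
    "c \<in> U" and \<sigma>: "\<sigma> \<in> {1, -1}"
    and uU: "\<And>s. s \<in> J \<Longrightarrow> u_of \<tau> s \<in> U"
    and eq: "\<And>s. s \<in> J \<Longrightarrow>
      (LBINT v=c..u_of \<tau> s. 1 / (\<sigma> * sqrt (radicand A C v))) = s + k"
    using int unfolding integral_formula_def by blast
  define f where "f = (\<lambda>v. 1 / (\<sigma> * sqrt (radicand A C v)))"
  define G where "G = (\<lambda>v. interval_primitive c f v - k)"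
  have G_u: "G (u_of \<tau> s) = s" if "s \<in> J" for s
    using eq[OF that] by (simp add: G_def f_def interval_primitive_def)
  have f_nz: "\<sigma> * f v > 0" if "v \<in> U" for v
    using U(4)[OF that] \<sigma> by (auto simp: f_def)
  have cont: "continuous_on U f"
    unfolding f_def using \<sigma> U(4)
    by (intro continuous_intros continuous_on_radicand U) force+
  have dG: "(G has_real_derivative f v) (at v)" if "v \<in> U" for v
    unfolding G_def
    using has_real_derivative_interval_primitive[OF U(1,2,5) that cont]
    by (auto intro!: derivative_eq_intros)
  \<comment> \<open>Multiplying by \<open>\<sigma>\<close> makes \<open>G\<close> increasing for
    either sign of the square root.\<close>
  have less: "\<sigma> * G v < \<sigma> * G w" if "v \<in> U" "w \<in> U" "v < w" for v w
  proof (rule DERIV_pos_imp_increasing[OF \<open>v < w\<close>])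
    fix x assume "v \<le> x" "x \<le> w"
    then have "x \<in> U"
      using U(2) that unfolding is_interval_1 by blast
    then show "\<exists>y. ((\<lambda>v. \<sigma> * G v) has_real_derivative y) (at x) \<and> 0 < y"
      using DERIV_cmult[OF dG, of x \<sigma>] f_nz by blast
  qed
  have inj: "v = w" if "v \<in> U" "w \<in> U" "G v = G w" for v w
    using less[of v w] less[of w v] that by (cases v w rule: linorder_cases) auto
  have contG: "continuous_on U G"
    using dG by (meson DERIV_isCont continuous_at_imp_continuous_on)
  have deriv: "(u_of \<tau> has_real_derivative \<sigma> * sqrt (radicand A C (u_of \<tau> s))) (at s)" if "s \<in> J" for s
  proof -
    \<comment> \<open>\<open>G\<close> may take values outside \<open>J\<close>, where nothing is
      known about \<open>u\<close>; on \<open>S\<close> the identity \<open>u (G z) = z\<close>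
      follows from injectivity of \<open>G\<close>.\<close>
    define S where "S = U \<inter> G -` J"
    have "open S"
      unfolding S_def using continuous_open_preimage[OF contG U(1) J] .
    moreover have "u_of \<tau> s \<in> S"
      using that uU G_u by (simp add: S_def)
    moreover have "u_of \<tau> (G z) = z" if "z \<in> S" for z
      using that inj[of "u_of \<tau> (G z)" z] uU G_u by (simp add: S_def)
    moreover have "continuous_on S G"
      using contG by (rule continuous_on_subset) (simp add: S_def)
    moreover have "f (u_of \<tau> s) \<noteq> 0"
      using f_nz[OF uU[OF that]] by auto
    ultimately have "(u_of \<tau> has_real_derivative inverse (f (u_of \<tau> s))) (at (G (u_of \<tau> s)))"
      using dG[OF uU[OF that]]
      unfolding has_field_derivative_def
      by (intro has_derivative_inverse_strong[where S = S and f = G and f' = "(*) (f (u_of \<tau> s))"])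
        (use \<open>f (u_of \<tau> s) \<noteq> 0\<close> in \<open>auto simp: fun_eq_iff\<close>)
    then show ?thesis
      using G_u[OF that] \<sigma> by (auto simp: f_def)
  qed
  show thesis
    by (rule that[OF \<sigma> U(4)[OF uU] deriv])
qed

text \<open>The root produced by differentiating \<open>sqrt\<close> cancels against the root in
  \<open>u'\<close>, and \<open>\<sigma> * \<sigma> = 1\<close>, so the second-order equation no
  longer sees the sign.\<close>

lemma derivative_signed_sqrt_radicand:
  assumes "(u has_real_derivative \<sigma> * sqrt (radicand A C (u s))) (at s)"
    and "u s > 0" "radicand A C (u s) > 0" "\<sigma> \<in> {1, -1}"
  shows "((\<lambda>r. \<sigma> * sqrt (radicand A C (u r))) has_real_derivative
    A - u s + 1 / u s ^ 3) (at s)"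
proof -
  have "\<sigma> * \<sigma> = 1"
    using assms(4) by auto
  have "((\<lambda>r. \<sigma> * sqrt (radicand A C (u r))) has_real_derivative
    \<sigma> * (inverse (sqrt (radicand A C (u s))) / 2 *
      (2 * (A - u s + 1 / u s ^ 3) * (\<sigma> * sqrt (radicand A C (u s)))))) (at s)"
    by (intro DERIV_cmult DERIV_chain2[OF DERIV_real_sqrt] radicand_has_derivative assms)
  also have "\<sigma> * (inverse (sqrt (radicand A C (u s))) / 2 *
      (2 * (A - u s + 1 / u s ^ 3) * (\<sigma> * sqrt (radicand A C (u s))))) =
    (\<sigma> * \<sigma>) * (A - u s + 1 / u s ^ 3) *
      (inverse (sqrt (radicand A C (u s))) * sqrt (radicand A C (u s)))"
    by algebra
  also have "\<dots> = A - u s + 1 / u s ^ 3"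
    using assms(3) \<open>\<sigma> * \<sigma> = 1\<close> by simp
  finally show ?thesis .
qed

section \<open>Smoothness of solutions by bootstrapping\<close>

text \<open>If \<open>u'\<close> is \<open>p\<close> and \<open>p'\<close> is a polynomial in \<open>u\<close> and \<open>1 / u\<close>, this algebra is closed under
  differentiation, so that its members are smooth.\<close>

inductive_set derivative_algebra :: "(real \<Rightarrow> real) \<Rightarrow> (real \<Rightarrow> real) \<Rightarrow> (real \<Rightarrow> real) set"
  for u p where
  const: "(\<lambda>_. c) \<in> derivative_algebra u p"
| u: "u \<in> derivative_algebra u p"
| inverse_u: "(\<lambda>s. 1 / u s) \<in> derivative_algebra u p"
| p: "p \<in> derivative_algebra u p"
| add: "f \<in> derivative_algebra u p \<Longrightarrow> g \<in> derivative_algebra u p \<Longrightarrow>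
    (\<lambda>s. f s + g s) \<in> derivative_algebra u p"
| mult: "f \<in> derivative_algebra u p \<Longrightarrow> g \<in> derivative_algebra u p \<Longrightarrow>
    (\<lambda>s. f s * g s) \<in> derivative_algebra u p"

lemma derivative_algebra_closed:
  assumes u: "\<And>s. s \<in> I \<Longrightarrow> u s > 0" "\<And>s. s \<in> I \<Longrightarrow> (u has_real_derivative p s) (at s)"
    and p: "\<And>s. s \<in> I \<Longrightarrow> (p has_real_derivative A - u s + 1 / u s ^ 3) (at s)"
    and f: "f \<in> derivative_algebra u p"
  shows "\<exists>g\<in>derivative_algebra u p. \<forall>s\<in>I. (f has_real_derivative g s) (at s)"
  using f
proof induction
  case (const c)
  show ?case
    by (rule bexI[OF _ derivative_algebra.const[of 0]]) auto
next
  case u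
  show ?case
    using assms(2) derivative_algebra.p by blast
next
  case inverse_u
  have mem: "(\<lambda>s. (- 1) * (p s * ((1 / u s) * (1 / u s)))) \<in> derivative_algebra u p"
    by (intro derivative_algebra.intros)
  have d: "\<forall>s\<in>I. ((\<lambda>s. 1 / u s) has_real_derivative (- 1) * (p s * ((1 / u s) * (1 / u s)))) (at s)"
    using u(1) by (fastforce intro!: derivative_eq_intros u(2))
  show ?case
    by (intro bexI[OF _ mem]) (fact d)
next
  case p
  have mem: "(\<lambda>s. A + ((- 1) * u s + (1 / u s) * ((1 / u s) * (1 / u s)))) \<in> derivative_algebra u p"
    by (intro derivative_algebra.intros)
  have d: "\<forall>s\<in>I. (p has_real_derivative A + ((- 1) * u s + (1 / u s) * ((1 / u s) * (1 / u s)))) (at s)"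
    using assms(3) by (simp add: power3_eq_cube algebra_simps)
  show ?case
    by (intro bexI[OF _ mem]) (fact d)
next
  case (add f g)
  then obtain f' g' where "f' \<in> derivative_algebra u p" "g' \<in> derivative_algebra u p"
    and d: "\<forall>s\<in>I. (f has_real_derivative f' s) (at s)" "\<forall>s\<in>I. (g has_real_derivative g' s) (at s)"
    by blast
  then have "(\<lambda>s. f' s + g' s) \<in> derivative_algebra u p"
    by (intro derivative_algebra.intros)
  then show ?case
    by (rule bexI[rotated]) (use d in \<open>auto intro!: derivative_eq_intros\<close>)
next
  case (mult f g)
  then obtain f' g' where "f' \<in> derivative_algebra u p" "g' \<in> derivative_algebra u p"
    and d: "\<forall>s\<in>I. (f has_real_derivative f' s) (at s)" "\<forall>s\<in>I. (g has_real_derivative g' s) (at s)"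
    by blast
  then have "(\<lambda>s. f' s * g s + g' s * f s) \<in> derivative_algebra u p"
    using mult.hyps by (intro derivative_algebra.intros)
  then show ?case
    by (rule bexI[rotated]) (use d in \<open>auto intro!: DERIV_mult\<close>)
qed

text \<open>Every iterated derivative of \<open>h\<close> agrees on \<open>I\<close> with some
  member of \<open>F\<close>. Because \<open>I\<close> is open, agreement on \<open>I\<close> is
  preserved by \<open>deriv\<close>, whatever the functions do elsewhere.\<close>

lemma smooth_onI_derivative_closed:
  assumes I: "open I" and F: "\<And>f. f \<in> F \<Longrightarrow> \<exists>g\<in>F. \<forall>s\<in>I. (f has_real_derivative g s) (at s)"
    and f: "f \<in> F" and eq: "\<And>s. s \<in> I \<Longrightarrow> h s = f s"
  shows "smooth_on I h"
proof -
  have "\<exists>g\<in>F. \<forall>s\<in>I. (deriv ^^ n) h s = g s" for n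
  proof (induction n)
    case 0
    then show ?case
      using f eq by auto
  next
    case (Suc n)
    then obtain g where "g \<in> F" and g: "\<forall>s\<in>I. (deriv ^^ n) h s = g s"
      by blast
    then obtain g' where "g' \<in> F" and g': "\<forall>s\<in>I. (g has_real_derivative g' s) (at s)"
      using F by blast
    have "((deriv ^^ n) h has_real_derivative g' s) (at s)" if "s \<in> I" for s
      by (rule has_field_derivative_transform_within_open[OF g'[rule_format, OF that] I that])
         (simp add: g)
    then have "\<forall>s\<in>I. (deriv ^^ Suc n) h s = g' s"
      by (auto intro!: DERIV_imp_deriv)
    then show ?case
      using \<open>g' \<in> F\<close> by blast
  qed
  moreover have "(deriv ^^ n) h differentiable (at s)"
    if "g \<in> F" "\<forall>s\<in>I. (deriv ^^ n) h s = g s" "s \<in> I" for n g s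
  proof -
    obtain g' where g': "\<forall>s\<in>I. (g has_real_derivative g' s) (at s)"
      using F \<open>g \<in> F\<close> by blast
    have "((deriv ^^ n) h has_real_derivative g' s) (at s)"
      by (rule has_field_derivative_transform_within_open[OF g'[rule_format, OF that(3)] I that(3)])
         (simp add: that(2))
    then show ?thesis
      using real_differentiable_def by blast
  qed
  ultimately show ?thesis
    unfolding smooth_on_def by blast
qed

section \<open>The flux and the second-order equation\<close>

lemma flux_eq:
  assumes "\<tau> s > 0"
  shows "flux \<tau> s = u_of \<tau> s - 1 / u_of \<tau> s ^ 3 + deriv (deriv (u_of \<tau>)) s"
  using powr_three_halves[of \<tau>, OF assms] unfolding flux_def by (simp add: u_of_def[abs_def])

text \<open>All routes back to stationarity end here. The system for \<open>u\<close> and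
  \<open>p\<close> fixes the flux, and it yields smoothness because \<open>\<tau>\<close> is the
  square of the generator \<open>1 / u\<close> of the derivative algebra.\<close>

lemma stationary_onI:
  assumes I: "open I" and u: "\<And>s. s \<in> I \<Longrightarrow> (u_of \<tau> has_real_derivative p s) (at s)"
    and p: "\<And>s. s \<in> I \<Longrightarrow> (p has_real_derivative A - u_of \<tau> s + 1 / u_of \<tau> s ^ 3) (at s)"
    and \<tau>: "\<And>s. s \<in> I \<Longrightarrow> \<tau> s > 0"
  shows "stationary_on I \<tau>" "\<forall>s\<in>I. flux \<tau> s = A"
proof -
  have p_eq: "deriv (u_of \<tau>) s = p s" if "s \<in> I" for s
    using u[OF that] by (rule DERIV_imp_deriv)
  have "deriv (deriv (u_of \<tau>)) s = A - u_of \<tau> s + 1 / u_of \<tau> s ^ 3" if "s \<in> I" for s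
    by (intro DERIV_imp_deriv has_field_derivative_transform_within_open[OF p[OF that] I that])
       (simp add: p_eq)
  then show flux: "\<forall>s\<in>I. flux \<tau> s = A"
    using flux_eq[of \<tau>, OF \<tau>] by simp
  have "((\<lambda>s. A) has_real_derivative 0) (at s)" for s
    by simp
  then have "(flux \<tau> has_real_derivative 0) (at s)" if "s \<in> I" for s
    by (rule has_field_derivative_transform_within_open[OF _ I that]) (use flux in simp)
  moreover have "smooth_on I \<tau>"
  proof (rule smooth_onI_derivative_closed[OF I])
    show "\<exists>g\<in>derivative_algebra (u_of \<tau>) p. \<forall>s\<in>I. (f has_real_derivative g s) (at s)"
      if "f \<in> derivative_algebra (u_of \<tau>) p" for f
      using derivative_algebra_closed[where u = "u_of \<tau>", OF u_of_pos[of \<tau>, OF \<tau>] u p that] .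
    show "(\<lambda>s. (1 / u_of \<tau> s) * (1 / u_of \<tau> s)) \<in> derivative_algebra (u_of \<tau>) p"
      by (intro derivative_algebra.intros)
  qed (use \<tau>_eq_u_of[of \<tau>, OF \<tau>] in \<open>simp add: power2_eq_square\<close>)
  ultimately show "stationary_on I \<tau>"
    using \<tau> by (simp add: stationary_on_def)
qed

text \<open>Two explicit differentiations of a power of \<open>\<tau>\<close>. Continuity of
  \<open>u''\<close> is recorded because the flux is later extended to turning points by a
  limit.\<close>

lemma u_of_derivatives:
  assumes I: "open I" and smooth: "smooth_on I \<tau>" and \<tau>: "\<And>s. s \<in> I \<Longrightarrow> \<tau> s > 0"
  shows "\<And>s. s \<in> I \<Longrightarrow> (u_of \<tau> has_real_derivative deriv (u_of \<tau>) s) (at s)"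
    and "\<And>s. s \<in> I \<Longrightarrow>
      (deriv (u_of \<tau>) has_real_derivative deriv (deriv (u_of \<tau>)) s) (at s)"
    and "continuous_on I (deriv (deriv (u_of \<tau>)))"
proof -
  define \<tau>1 where "\<tau>1 = deriv \<tau>"
  define \<tau>2 where "\<tau>2 = deriv \<tau>1"
  have diff: "(deriv ^^ n) \<tau> differentiable (at s)" if "s \<in> I" for n s
    using smooth that unfolding smooth_on_def by blast
  have d: "\<tau> differentiable (at s)" "\<tau>1 differentiable (at s)" "\<tau>2 differentiable (at s)"
    if "s \<in> I" for s
    using diff[OF that, of 0] diff[OF that, of 1] diff[OF that, of 2]
    by (simp_all add: \<tau>1_def \<tau>2_def numeral_2_eq_2)
  have D: "(\<tau> has_real_derivative \<tau>1 s) (at s)" "(\<tau>1 has_real_derivative \<tau>2 s) (at s)"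
    if "s \<in> I" for s
    using d[OF that] unfolding \<tau>1_def \<tau>2_def
    by (metis DERIV_deriv_iff_real_differentiable)+
  have c: "continuous_on I \<tau>" "continuous_on I \<tau>1" "continuous_on I \<tau>2"
    using d by (meson differentiable_imp_continuous_within continuous_at_imp_continuous_on)+
  define p where "p s = - 1 / 2 * (\<tau> s powr (- 3 / 2) * \<tau>1 s)" for s
  define q where "q s = - 1 / 2 * ((- 3 / 2 * \<tau> s powr (- 5 / 2) * \<tau>1 s) * \<tau>1 s
      + \<tau>2 s * \<tau> s powr (- 3 / 2))" for s
  have u: "(u_of \<tau> has_real_derivative p s) (at s)" if "s \<in> I" for s
    unfolding u_of_def[abs_def] p_def
    using DERIV_chain2[OF has_real_derivative_powr[of "\<tau> s" "- 1 / 2"] D(1)[OF that]] \<tau>[OF that]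
    by (simp add: mult.assoc)
  have p: "(p has_real_derivative q s) (at s)" if "s \<in> I" for s
    unfolding p_def[abs_def] q_def
  proof (intro DERIV_cmult DERIV_mult D that)
    show "((\<lambda>s. \<tau> s powr (- 3 / 2)) has_real_derivative - 3 / 2 * \<tau> s powr (- 5 / 2) * \<tau>1 s) (at s)"
      using DERIV_chain2[OF has_real_derivative_powr[of "\<tau> s" "- 3 / 2"] D(1)[OF that]] \<tau>[OF that]
      by simp
  qed
  have q: "continuous_on I q"
    unfolding q_def[abs_def] by (intro continuous_intros c) (use \<tau> in force)+
  have p_eq: "deriv (u_of \<tau>) s = p s" if "s \<in> I" for s
    using u[OF that] by (rule DERIV_imp_deriv)
  have p': "(deriv (u_of \<tau>) has_real_derivative q s) (at s)" if "s \<in> I" for s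
    by (rule has_field_derivative_transform_within_open[OF p[OF that] I that]) (simp add: p_eq)
  have q_eq: "deriv (deriv (u_of \<tau>)) s = q s" if "s \<in> I" for s
    using p'[OF that] by (rule DERIV_imp_deriv)
  show "(u_of \<tau> has_real_derivative deriv (u_of \<tau>) s) (at s)" if "s \<in> I" for s
    using u[OF that] by (simp add: p_eq[OF that])
  show "(deriv (u_of \<tau>) has_real_derivative deriv (deriv (u_of \<tau>)) s) (at s)" if "s \<in> I" for s
    using p'[OF that] by (simp add: q_eq[OF that])
  show "continuous_on I (deriv (deriv (u_of \<tau>)))"
    using q by (simp add: q_eq cong: continuous_on_cong)
qed

section \<open>The first integral and its turning points\<close>

lemma is_interval_zero_derivative_constant:
  fixes I :: "real set"
  assumes "is_interval I" "\<And>s. s \<in> I \<Longrightarrow> (f has_real_derivative 0) (at s)"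
  shows "\<exists>c. \<forall>s\<in>I. f s = c"
  using assms
  by (intro has_field_derivative_zero_constant)
     (auto simp: is_interval_convex_1 intro: has_field_derivative_at_within)

lemma first_integral:
  fixes I :: "real set"
  assumes I: "is_interval I" and u: "\<And>s. s \<in> I \<Longrightarrow> (u has_real_derivative p s) (at s)"
    and p: "\<And>s. s \<in> I \<Longrightarrow> (p has_real_derivative A - u s + 1 / u s ^ 3) (at s)"
    and pos: "\<And>s. s \<in> I \<Longrightarrow> u s > 0"
  shows "\<exists>C. \<forall>s\<in>I. p s ^ 2 = radicand A C (u s)"
proof -
  \<comment> \<open>The constant \<open>C\<close> enters the radicand additively, so it appears as
    the constant value of \<open>p\<^sup>2\<close> minus the radicand with \<open>C = 0\<close>; the
    derivative is \<open>2 * p * p' - 2 * p' * p\<close>.\<close>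
  have "((\<lambda>s. p s ^ 2 - radicand A 0 (u s)) has_real_derivative 0) (at s)" if "s \<in> I" for s
    by (rule derivative_eq_intros p[OF that] radicand_has_derivative[OF u pos] that refl)+ simp
  from is_interval_zero_derivative_constant[OF I this]
  obtain C where "p s ^ 2 - radicand A 0 (u s) = C" if "s \<in> I" for s
    by blast
  then have "\<forall>s\<in>I. p s ^ 2 = radicand A C (u s)"
    by (fastforce simp: radicand_def)
  then show ?thesis ..
qed

text \<open>The hypotheses on \<open>w\<close> say that the radicand and its derivative both vanish
  there. Solving them for \<open>A\<close> and \<open>C\<close> and substituting lets the square of
  \<open>v - w\<close> be factored out.\<close>

lemma radicand_double_root:
  assumes "v > 0" "w > 0" "A - w + 1 / w ^ 3 = 0" "radicand A C w = 0"
  shows "radicand A C v = - ((v - w)\<^sup>2 * (1 + (2 * v + w) / (w ^ 3 * v\<^sup>2)))"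
proof -
  have A: "A = w - 1 / w ^ 3"
    using assms(3) by simp
  have C: "C = - 2 * A * w + w\<^sup>2 + 1 / w\<^sup>2"
    using assms(4) by (simp add: radicand_def)
  show ?thesis
    unfolding radicand_def C A using assms(1,2)
    by (simp add: field_simps) algebra
qed

lemma radicand_double_root_unique:
  assumes "v > 0" "w > 0" "A - w + 1 / w ^ 3 = 0" "radicand A C w = 0" "radicand A C v \<ge> 0"
  shows "v = w"
proof (rule ccontr)
  assume "v \<noteq> w"
  have "1 + (2 * v + w) / (w ^ 3 * v\<^sup>2) > 0"
    using assms(1,2) by (simp add: add_pos_pos)
  with \<open>v \<noteq> w\<close> have "(v - w)\<^sup>2 * (1 + (2 * v + w) / (w ^ 3 * v\<^sup>2)) > 0"
    by simp
  then show False
    using radicand_double_root[OF assms(1-4)] assms(5) by linarith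
qed

lemma turning_points_isolated:
  fixes I :: "real set"
  assumes I: "open I" and u: "\<And>s. s \<in> I \<Longrightarrow> (u has_real_derivative p s) (at s)"
    and p: "\<And>s. s \<in> I \<Longrightarrow> (p has_real_derivative A - u s + 1 / u s ^ 3) (at s)"
    and pos: "\<And>s. s \<in> I \<Longrightarrow> u s > 0"
    and C: "\<And>s. s \<in> I \<Longrightarrow> p s ^ 2 = radicand A C (u s)"
    and nonconst: "\<not> u constant_on I" and s: "s \<in> I"
  shows "\<forall>\<^sub>F r in at s. radicand A C (u r) > 0"
proof -
  have "\<forall>\<^sub>F r in at s. p r \<noteq> 0"
  proof (cases "p s = 0")
    case False
    have "(p \<longlongrightarrow> p s) (at s)"
      using DERIV_isCont[OF p[OF s]] by (simp add: isCont_def)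
    then show ?thesis
      using False by (rule tendsto_imp_eventually_ne)
  next
    case True
    \<comment> \<open>Otherwise \<open>u s\<close> is a double root. The radicand is a square along
      \<open>u\<close>, hence nonnegative, which forces \<open>u r = u s\<close> for every
      \<open>r\<close> in \<open>I\<close>.\<close>
    have "A - u s + 1 / u s ^ 3 \<noteq> 0"
    proof
      assume "A - u s + 1 / u s ^ 3 = 0"
      then have "u r = u s" if "r \<in> I" for r
        using radicand_double_root_unique[OF pos[OF that] pos[OF s], of A C]
          C[OF that] C[OF s] True by (metis zero_le_power2 power_zero_numeral)
      then show False
        using nonconst unfolding constant_on_def by blast
    qed
    \<comment> \<open>The zero of \<open>p\<close> is simple: a difference quotient with nonzero
      limit keeps \<open>p\<close> away from zero in a punctured neighbourhood.\<close>
    moreover have "((\<lambda>r. (p r - p s) / (r - s)) \<longlongrightarrow> A - u s + 1 / u s ^ 3) (at s)"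
      using p[OF s] by (simp add: has_field_derivative_iff)
    ultimately have "\<forall>\<^sub>F r in at s. (p r - p s) / (r - s) \<noteq> 0"
      by (intro tendsto_imp_eventually_ne)
    then show ?thesis
      by eventually_elim (use True in auto)
  qed
  moreover have "\<forall>\<^sub>F r in at s. r \<in> I"
    using eventually_at_in_open'[OF I s] .
  ultimately show ?thesis
    by eventually_elim (simp flip: C)
qed

section \<open>Separation of variables\<close>

lemma integral_formulaI:
  assumes J: "open J" "is_interval J" "J \<noteq> {}" and pos: "\<And>s. s \<in> J \<Longrightarrow> u_of \<tau> s > 0"
    and u: "\<And>s. s \<in> J \<Longrightarrow> (u_of \<tau> has_real_derivative p s) (at s)"
    and p: "continuous_on J p" "\<And>s. s \<in> J \<Longrightarrow> p s ^ 2 = radicand A C (u_of \<tau> s)"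
    and rad: "\<And>s. s \<in> J \<Longrightarrow> radicand A C (u_of \<tau> s) > 0"
  shows "\<exists>k. integral_formula A C k \<tau> J"
proof -
  obtain s0 where "s0 \<in> J"
    using J(3) by blast
  define c where "c = u_of \<tau> s0"
  define S where "S = {0<..} \<inter> radicand A C -` {0<..}"
  define U where "U = connected_component_set S c"
  have "open S"
    unfolding S_def by (rule continuous_open_preimage[OF continuous_on_radicand]) auto
  have "U \<subseteq> S"
    unfolding U_def by (rule connected_component_subset)
  have U: "open U" "is_interval U" "U \<subseteq> {0<..}" "\<And>v. v \<in> U \<Longrightarrow> radicand A C v > 0"
    using \<open>open S\<close> \<open>U \<subseteq> S\<close>
    by (auto simp: U_def S_def open_connected_component is_interval_connected_1)
  have contu: "continuous_on J (u_of \<tau>)"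
    using u by (meson DERIV_isCont continuous_at_imp_continuous_on)
  have "u_of \<tau> ` J \<subseteq> U"
    unfolding U_def
  proof (rule connected_component_maximal)
    show "connected (u_of \<tau> ` J)"
      using contu J(2) by (simp add: connected_continuous_image is_interval_connected_1)
  qed (use \<open>s0 \<in> J\<close> pos rad in \<open>auto simp: c_def S_def\<close>)
  then have uU: "u_of \<tau> s \<in> U" if "s \<in> J" for s
    using that by blast
  then have "c \<in> U"
    using \<open>s0 \<in> J\<close> by (simp add: c_def)
  have p_nz: "p s \<noteq> 0" if "s \<in> J" for s
    using p(2)[OF that] rad[OF that] by auto
  define \<sigma> where "\<sigma> = sgn (p s0)"
  have \<sigma>: "\<sigma> \<in> {1, -1}"
    using p_nz[OF \<open>s0 \<in> J\<close>] by (auto simp: \<sigma>_def sgn_if)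
  \<comment> \<open>\<open>p\<close> has no zero on \<open>J\<close>, so by the intermediate value
    property its sign at \<open>s0\<close> is its sign throughout.\<close>
  have "\<sigma> * p s > 0" if "s \<in> J" for s
  proof (rule ccontr)
    assume "\<not> \<sigma> * p s > 0"
    then have "\<sigma> * p s < 0" "\<sigma> * p s0 > 0"
      using p_nz[OF that] p_nz[OF \<open>s0 \<in> J\<close>] \<sigma> by (auto simp: \<sigma>_def sgn_if split: if_splits)
    moreover have "connected ((\<lambda>s. \<sigma> * p s) ` J)"
      using J(2) p(1)
      by (intro connected_continuous_image continuous_intros) (simp_all add: is_interval_connected_1)
    then have "is_interval ((\<lambda>s. \<sigma> * p s) ` J)"
      by (simp add: is_interval_connected_1)
    ultimately have "0 \<in> (\<lambda>s. \<sigma> * p s) ` J"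
      using that \<open>s0 \<in> J\<close> unfolding is_interval_1 by (meson imageI less_imp_le)
    then show False
      using p_nz \<sigma> by auto
  qed
  then have p_eq: "p s = \<sigma> * sqrt (radicand A C (u_of \<tau> s))" if "s \<in> J" for s
    using \<sigma> that by (auto simp flip: p(2)) (use that in force)+
  define f where "f v = 1 / (\<sigma> * sqrt (radicand A C v))" for v
  have contf: "continuous_on U f"
    unfolding f_def[abs_def] using \<sigma> U(4)
    by (intro continuous_intros continuous_on_radicand U) force+
  \<comment> \<open>By the chain rule the primitive along \<open>u\<close> has derivative
    \<open>f (u s) * p s = 1\<close>; the constant of integration is \<open>k\<close>.\<close>
  have "((\<lambda>s. interval_primitive c f (u_of \<tau> s) - s) has_real_derivative 0) (at s)"
    if "s \<in> J" for s
  proof -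
    have "f (u_of \<tau> s) * p s = 1"
      using rad[OF that] \<sigma> by (auto simp: p_eq[OF that] f_def)
    then show ?thesis
      using DERIV_chain2[OF has_real_derivative_interval_primitive[OF U(1,2) \<open>c \<in> U\<close> uU contf] u]
        that by (auto intro!: derivative_eq_intros)
  qed
  from is_interval_zero_derivative_constant[OF J(2) this]
  obtain k where "\<forall>s\<in>J. interval_primitive c f (u_of \<tau> s) - s = k"
    by blast
  then have "\<forall>s\<in>J. (LBINT v=c..u_of \<tau> s. 1 / (\<sigma> * sqrt (radicand A C v))) = s + k"
    by (fastforce simp: interval_primitive_def f_def)
  then show ?thesis
    unfolding integral_formula_def using U \<open>c \<in> U\<close> \<sigma> uU by blast
qed

section \<open>Stationary solutions and the integral formula\<close>

lemma constant_on_u_of_iff: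
  assumes "\<And>s. s \<in> I \<Longrightarrow> \<tau> s > 0"
  shows "u_of \<tau> constant_on I \<longleftrightarrow> \<tau> constant_on I"
  using \<tau>_eq_u_of[of \<tau>, OF assms] unfolding constant_on_def by (metis u_of_def)

lemma nonconstant_if_derivative_nonzero:
  assumes I: "open I" and "s \<in> I" and "(u has_real_derivative d) (at s)" "d \<noteq> 0"
  shows "\<not> u constant_on I"
proof
  assume "u constant_on I"
  then obtain c where "\<And>r. r \<in> I \<Longrightarrow> u r = c"
    unfolding constant_on_def by blast
  then have "(u has_real_derivative 0) (at s)"
    using has_field_derivative_transform_within_open[OF DERIV_const I \<open>s \<in> I\<close>, of c u] by simp
  then show False
    using DERIV_unique assms(3,4) by blast
qed

lemma stationary_imp_ode:
  assumes I: "open I" and stat: "stationary_on I \<tau>" and flux: "\<forall>s\<in>I. flux \<tau> s = A"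
    and s: "s \<in> I"
  shows "(u_of \<tau> has_real_derivative deriv (u_of \<tau>) s) (at s)"
    and "(deriv (u_of \<tau>) has_real_derivative A - u_of \<tau> s + 1 / u_of \<tau> s ^ 3) (at s)"
proof -
  have smooth: "smooth_on I \<tau>" and pos: "\<And>s. s \<in> I \<Longrightarrow> \<tau> s > 0"
    using stat by (auto simp: stationary_on_def)
  show "(u_of \<tau> has_real_derivative deriv (u_of \<tau>) s) (at s)"
    using u_of_derivatives(1)[OF I smooth pos] s by blast
  have "deriv (deriv (u_of \<tau>)) s = A - u_of \<tau> s + 1 / u_of \<tau> s ^ 3"
    using flux_eq[of \<tau>, OF pos[OF s]] flux s by simp
  then show "(deriv (u_of \<tau>) has_real_derivative A - u_of \<tau> s + 1 / u_of \<tau> s ^ 3) (at s)"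
    using u_of_derivatives(2)[OF I smooth pos] s by metis
qed

lemma stationary_imp_flux_constant:
  assumes "is_interval I" "stationary_on I \<tau>"
  shows "\<exists>A. \<forall>s\<in>I. flux \<tau> s = A"
  using is_interval_zero_derivative_constant[OF assms(1), of "flux \<tau>"] assms(2)
  by (auto simp: stationary_on_def)

lemma stationary_imp_given_by_integral:
  assumes I: "open I" "is_interval I" and stat: "stationary_on I \<tau>"
    and flux: "\<forall>s\<in>I. flux \<tau> s = A" and nonconst: "\<not> \<tau> constant_on I"
  shows "\<exists>C. given_by_integral A C \<tau> I"
proof -
  have pos: "\<tau> s > 0" if "s \<in> I" for s
    using stat that by (simp add: stationary_on_def)
  note upos = u_of_pos[of \<tau>, OF pos]
  define p where "p = deriv (u_of \<tau>)"
  have u: "(u_of \<tau> has_real_derivative p s) (at s)"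
    and p: "(p has_real_derivative A - u_of \<tau> s + 1 / u_of \<tau> s ^ 3) (at s)" if "s \<in> I" for s
    using stationary_imp_ode[OF I(1) stat flux that] by (simp_all add: p_def)
  obtain C where C: "\<And>s. s \<in> I \<Longrightarrow> p s ^ 2 = radicand A C (u_of \<tau> s)"
    using first_integral[OF I(2) u p upos] by blast
  have "\<not> u_of \<tau> constant_on I"
    using nonconst constant_on_u_of_iff[of I \<tau>, OF pos] by blast
  then have "\<forall>\<^sub>F r in at s. radicand A C (u_of \<tau> r) > 0" if "s \<in> I" for s
    using turning_points_isolated[OF I(1) u p upos C] that by blast
  moreover have "\<exists>k. integral_formula A C k \<tau> J"
    if "open J" "is_interval J" "J \<noteq> {}" "J \<subseteq> I" "\<forall>s\<in>J. radicand A C (u_of \<tau> s) > 0" for J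
  proof (rule integral_formulaI)
    show "continuous_on J p"
      using p that(4) by (meson DERIV_isCont continuous_at_imp_continuous_on subsetD)
  qed (use that upos u C in auto)
  ultimately show ?thesis
    unfolding given_by_integral_def by blast
qed

text \<open>The formula gives the first-order equation, whose right-hand side is differentiable
  again, so the second-order system holds. Non-constancy holds because \<open>u'\<close> is a signed
  root of a positive number.\<close>

lemma integral_formula_imp_stationary:
  assumes I: "open I" "I \<noteq> {}" and pos: "\<And>s. s \<in> I \<Longrightarrow> \<tau> s > 0"
    and int: "integral_formula A C k \<tau> I"
  shows "stationary_on I \<tau>" "\<forall>s\<in>I. flux \<tau> s = A" "\<not> \<tau> constant_on I"
proof -
  note upos = u_of_pos[of \<tau>, OF pos]
  obtain \<sigma> where \<sigma>: "\<sigma> \<in> {1, -1}" and rad: "\<And>s. s \<in> I \<Longrightarrow> radicand A C (u_of \<tau> s) > 0"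
    and u: "\<And>s. s \<in> I \<Longrightarrow>
      (u_of \<tau> has_real_derivative \<sigma> * sqrt (radicand A C (u_of \<tau> s))) (at s)"
    using u_of_derivative_of_integral_formula[OF I(1) int] by blast
  have "((\<lambda>r. \<sigma> * sqrt (radicand A C (u_of \<tau> r))) has_real_derivative
      A - u_of \<tau> s + 1 / u_of \<tau> s ^ 3) (at s)" if "s \<in> I" for s
    using derivative_signed_sqrt_radicand[where u = "u_of \<tau>", OF u upos rad \<sigma>] that by blast
  from stationary_onI[OF I(1) u this pos]
  show "stationary_on I \<tau>" "\<forall>s\<in>I. flux \<tau> s = A"
    by blast+
  obtain s where "s \<in> I"
    using I(2) by blast
  moreover have "\<sigma> * sqrt (radicand A C (u_of \<tau> s)) \<noteq> 0"
    using \<sigma> rad[OF \<open>s \<in> I\<close>] by auto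
  ultimately have "\<not> u_of \<tau> constant_on I"
    using nonconstant_if_derivative_nonzero[OF I(1) _ u[OF \<open>s \<in> I\<close>]] by blast
  then show "\<not> \<tau> constant_on I"
    using constant_on_u_of_iff[of I \<tau>, OF pos] by blast
qed

text \<open>\<open>given_by_integral\<close> speaks only of whole intervals with positive radicand.
  Continuity of \<open>u\<close> makes positivity an open condition, so a small ball around
  \<open>s\<close> is such an interval.\<close>

lemma given_by_integral_locally:
  assumes I: "open I" and \<tau>: "\<And>s. s \<in> I \<Longrightarrow> \<tau> s > 0"
    and cont: "continuous_on I (u_of \<tau>)" and given: "given_by_integral A C \<tau> I"
    and s: "s \<in> I" "radicand A C (u_of \<tau> s) > 0"
  obtains J k where "open J" "s \<in> J" "J \<subseteq> I" "integral_formula A C k \<tau> J"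
proof -
  have "continuous_on I (\<lambda>s. radicand A C (u_of \<tau> s))"
    using continuous_on_compose2[OF continuous_on_radicand cont, of "{0<..}" A C] u_of_pos[of \<tau>, OF \<tau>]
    by auto
  then have "open (I \<inter> (\<lambda>s. radicand A C (u_of \<tau> s)) -` {0<..})"
    using I by (intro continuous_open_preimage) auto
  then obtain e where e: "e > 0" "ball s e \<subseteq> I \<inter> (\<lambda>s. radicand A C (u_of \<tau> s)) -` {0<..}"
    using s unfolding open_contains_ball by blast
  then have "open (ball s e) \<and> is_interval (ball s e) \<and> ball s e \<noteq> {} \<and> ball s e \<subseteq> I \<and>
    (\<forall>r\<in>ball s e. radicand A C (u_of \<tau> r) > 0)"
    by (auto simp: is_interval_ball_real)
  then obtain k where "integral_formula A C k \<tau> (ball s e)"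
    using given unfolding given_by_integral_def by blast
  with e show thesis
    by (intro that[of "ball s e" k]) auto
qed

text \<open>Away from turning points the integral formula gives flux \<open>A\<close>. Turning
  points are isolated and the flux of a smooth \<open>\<tau>\<close> is continuous, so the value
  \<open>A\<close> persists there by uniqueness of limits.\<close>

lemma given_by_integral_imp_stationary:
  assumes I: "open I" "I \<noteq> {}" and smooth: "smooth_on I \<tau>" and pos: "\<And>s. s \<in> I \<Longrightarrow> \<tau> s > 0"
    and given: "given_by_integral A C \<tau> I"
  shows "stationary_on I \<tau>" "\<forall>s\<in>I. flux \<tau> s = A" "\<not> \<tau> constant_on I"
proof -
  note upos = u_of_pos[of \<tau>, OF pos]
  define p q where "p = deriv (u_of \<tau>)" and "q = deriv p"
  have u: "(u_of \<tau> has_real_derivative p s) (at s)"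
    and p: "(p has_real_derivative q s) (at s)"
    and fl: "flux \<tau> s = u_of \<tau> s - 1 / u_of \<tau> s ^ 3 + q s" if "s \<in> I" for s
    using u_of_derivatives(1,2)[OF I(1) smooth pos that] flux_eq[of \<tau>, OF pos[OF that]]
    by (simp_all add: p_def q_def)
  have q: "continuous_on I q"
    using u_of_derivatives(3)[OF I(1) smooth pos] by (simp add: p_def q_def)
  have contu: "continuous_on I (u_of \<tau>)"
    using u by (meson DERIV_isCont continuous_at_imp_continuous_on)
  have local: "flux \<tau> s = A" "\<not> \<tau> constant_on I"
    if s: "s \<in> I" "radicand A C (u_of \<tau> s) > 0" for s
  proof -
    obtain J k where J: "open J" "s \<in> J" "J \<subseteq> I" "integral_formula A C k \<tau> J"
      using given_by_integral_locally[where \<tau> = \<tau>, OF I(1) pos contu given s] by blast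
    then have "J \<noteq> {}" "\<And>s. s \<in> J \<Longrightarrow> \<tau> s > 0"
      using pos by auto
    note J' = integral_formula_imp_stationary[where \<tau> = \<tau>, OF J(1) this J(4)]
    show "flux \<tau> s = A"
      using J'(2) J(2) by blast
    show "\<not> \<tau> constant_on I"
      using J'(3) J(3) constant_on_subset by blast
  qed
  have regular: "\<forall>\<^sub>F r in at s. r \<in> I \<and> radicand A C (u_of \<tau> r) > 0" if "s \<in> I" for s
    using given that eventually_at_in_open'[OF I(1) that]
    unfolding given_by_integral_def by (simp add: eventually_conj)
  show flux: "\<forall>s\<in>I. flux \<tau> s = A"
  proof
    fix s assume s: "s \<in> I"
    have "continuous_on I (\<lambda>s. u_of \<tau> s - 1 / u_of \<tau> s ^ 3 + q s)"
      by (intro continuous_intros contu q) (use upos in force)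
    then have "((\<lambda>s. u_of \<tau> s - 1 / u_of \<tau> s ^ 3 + q s) \<longlongrightarrow> flux \<tau> s) (at s)"
      using s I(1) by (simp add: continuous_on_eq_continuous_at isCont_def fl)
    moreover have "((\<lambda>s. u_of \<tau> s - 1 / u_of \<tau> s ^ 3 + q s) \<longlongrightarrow> A) (at s)"
      by (rule tendsto_eventually, use regular[OF s] in eventually_elim) (metis fl local(1))
    ultimately show "flux \<tau> s = A"
      using tendsto_unique trivial_limit_at by blast
  qed
  show "\<not> \<tau> constant_on I"
  proof -
    obtain s where "s \<in> I"
      using I(2) by blast
    from eventually_happens[OF regular[OF this]] show ?thesis
      using local(2) by auto
  qed
  have "q s = A - u_of \<tau> s + 1 / u_of \<tau> s ^ 3" if "s \<in> I" for s
    using fl[OF that] flux that by simp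
  then have "(p has_real_derivative A - u_of \<tau> s + 1 / u_of \<tau> s ^ 3) (at s)" if "s \<in> I" for s
    using p[OF that] that by simp
  from stationary_onI(1)[OF I(1) u this pos] show "stationary_on I \<tau>"
    by blast
qed

section \<open>The explicit solutions for \<open>A = 0\<close>\<close>

text \<open>The vector \<open>(2 * z, z')\<close> turns with angular speed 2. Rotating it back by
  the angle \<open>2 * s\<close> leaves a constant vector, whose components are \<open>a\<close> and
  \<open>b\<close>.\<close>

lemma harmonic_oscillator:
  fixes I :: "real set"
  assumes I: "is_interval I" and z: "\<And>s. s \<in> I \<Longrightarrow> (z has_real_derivative z' s) (at s)"
    and z': "\<And>s. s \<in> I \<Longrightarrow> (z' has_real_derivative - 4 * z s) (at s)"
  obtains a b where "\<And>s. s \<in> I \<Longrightarrow> 2 * z s = a * sin (2 * s) + b * cos (2 * s)"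
    and "\<And>s. s \<in> I \<Longrightarrow> z' s = a * cos (2 * s) - b * sin (2 * s)"
proof -
  have d1: "((\<lambda>s. 2 * z s * sin (2 * s) + z' s * cos (2 * s)) has_real_derivative 0) (at s)"
    if "s \<in> I" for s
    by (rule derivative_eq_intros z[OF that] z'[OF that] refl)+ (simp add: algebra_simps)
  have d2: "((\<lambda>s. 2 * z s * cos (2 * s) - z' s * sin (2 * s)) has_real_derivative 0) (at s)"
    if "s \<in> I" for s
    by (rule derivative_eq_intros z[OF that] z'[OF that] refl)+ (simp add: algebra_simps)
  obtain a where a: "\<And>s. s \<in> I \<Longrightarrow> 2 * z s * sin (2 * s) + z' s * cos (2 * s) = a"
    using is_interval_zero_derivative_constant[OF I d1] by blast
  obtain b where b: "\<And>s. s \<in> I \<Longrightarrow> 2 * z s * cos (2 * s) - z' s * sin (2 * s) = b"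
    using is_interval_zero_derivative_constant[OF I d2] by blast
  have one: "sin (2 * s) * sin (2 * s) + cos (2 * s) * cos (2 * s) = 1" for s :: real
    using sin_cos_squared_add3 by (metis add.commute)
  show thesis
  proof (rule that)
    fix s assume "s \<in> I"
    show "2 * z s = a * sin (2 * s) + b * cos (2 * s)"
      using one[of s] unfolding a[OF \<open>s \<in> I\<close>, symmetric] b[OF \<open>s \<in> I\<close>, symmetric] by algebra
    show "z' s = a * cos (2 * s) - b * sin (2 * s)"
      using one[of s] unfolding a[OF \<open>s \<in> I\<close>, symmetric] b[OF \<open>s \<in> I\<close>, symmetric] by algebra
  qed
qed

lemma explicit_form_of_first_integral:
  assumes I: "open I" "is_interval I" "I \<noteq> {}" and u: "\<And>s. s \<in> I \<Longrightarrow> (u_of \<tau> has_real_derivative p s) (at s)"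
    and p: "\<And>s. s \<in> I \<Longrightarrow> (p has_real_derivative 0 - u_of \<tau> s + 1 / u_of \<tau> s ^ 3) (at s)"
    and pos: "\<And>s. s \<in> I \<Longrightarrow> \<tau> s > 0"
    and C: "\<And>s. s \<in> I \<Longrightarrow> p s ^ 2 = radicand 0 C (u_of \<tau> s)"
  shows "C \<ge> 2 \<and> (\<exists>k. explicit_form C k \<tau> I)"
proof -
  note upos = u_of_pos[of \<tau>, OF pos]
  obtain s0 where s0: "s0 \<in> I"
    using I(3) by blast
  define w where "w = u_of \<tau> s0"
  have "w > 0"
    using upos[OF s0] by (simp add: w_def)
  \<comment> \<open>The bound on \<open>C\<close> comes from completing the square in
    \<open>w\<^sup>2 + 1 / w\<^sup>2\<close>.\<close>
  have "C - 2 = p s0 ^ 2 + (w - 1 / w)\<^sup>2"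
    using C[OF s0] \<open>w > 0\<close> by (simp add: radicand_def w_def power2_eq_square field_simps)
  then have "C \<ge> 2"
    by (smt (verit) zero_le_power2)
  \<comment> \<open>Subtracting the equilibrium \<open>C / 2\<close> from
    \<open>y = u\<^sup>2\<close> makes the oscillator equation homogeneous.\<close>
  define z where "z s = u_of \<tau> s ^ 2 - C / 2" for s
  define z' where "z' s = 2 * u_of \<tau> s * p s" for s
  have dz: "(z has_real_derivative z' s) (at s)" if "s \<in> I" for s
    unfolding z_def[abs_def] z'_def by (rule derivative_eq_intros u[OF that] refl)+ simp
  have dz': "(z' has_real_derivative - 4 * z s) (at s)" if "s \<in> I" for s
  proof -
    have "(z' has_real_derivative 2 * p s ^ 2 + 2 * u_of \<tau> s * (0 - u_of \<tau> s + 1 / u_of \<tau> s ^ 3)) (at s)"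
      unfolding z'_def[abs_def]
      by (rule derivative_eq_intros u[OF that] p[OF that] refl)+ (simp add: power2_eq_square)
    moreover have "2 * p s ^ 2 + 2 * u_of \<tau> s * (0 - u_of \<tau> s + 1 / u_of \<tau> s ^ 3) = - 4 * z s"
      using upos[OF that]
      unfolding C[OF that] by (simp add: radicand_def z_def field_simps) algebra
    ultimately show ?thesis
      by simp
  qed
  obtain a b where z_eq: "\<And>s. s \<in> I \<Longrightarrow> 2 * z s = a * sin (2 * s) + b * cos (2 * s)"
    and z'_eq: "\<And>s. s \<in> I \<Longrightarrow> z' s = a * cos (2 * s) - b * sin (2 * s)"
    using harmonic_oscillator[OF I(2) dz dz'] by blast
  define R where "R = sqrt (C\<^sup>2 - 4)"
  have "C\<^sup>2 \<ge> 4"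
    using power_mono[OF \<open>C \<ge> 2\<close>, of 2] by simp
  then have R2: "R\<^sup>2 = C\<^sup>2 - 4"
    by (simp add: R_def)
  \<comment> \<open>The squared amplitude is the energy, evaluated at the single point
    \<open>s0\<close>.\<close>
  have "a\<^sup>2 + b\<^sup>2 = (2 * z s0)\<^sup>2 + (z' s0)\<^sup>2"
    unfolding z_eq[OF s0] z'_eq[OF s0] using sin_cos_squared_add[of "2 * s0"] by algebra
  also have "\<dots> = C\<^sup>2 - 4"
    using \<open>w > 0\<close> C[OF s0]
    by (simp add: z_def z'_def w_def[symmetric] power_mult_distrib radicand_def)
       (simp add: field_simps power2_eq_square)
  finally have ab: "a\<^sup>2 + b\<^sup>2 = R\<^sup>2"
    by (simp add: R2)
  \<comment> \<open>Polar coordinates for \<open>(a, b)\<close>; when \<open>R = 0\<close>, that is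
    \<open>C = 2\<close>, any angle would do.\<close>
  obtain \<theta> where \<theta>: "a = R * cos \<theta>" "b = R * sin \<theta>"
  proof (cases "R = 0")
    case True
    then show thesis
      using ab that[of 0] by (simp add: sum_power2_eq_zero_iff)
  next
    case False
    then have "(a / R)\<^sup>2 + (b / R)\<^sup>2 = 1"
      using ab by (simp add: power_divide flip: add_divide_distrib)
    then obtain t where "a / R = cos t" "b / R = sin t"
      using sincos_total_2pi by metis
    with False show thesis
      using that[of t] by (simp add: field_simps)
  qed
  \<comment> \<open>The phase absorbs the sign of the sine term, so the choice
    \<open>\<sigma> = 1\<close> suffices, with \<open>k = \<theta> / 2\<close>.\<close>
  have "\<tau> s = 2 / (C + 1 * sqrt (C\<^sup>2 - 4) * sin (2 * (s + \<theta> / 2)))" if "s \<in> I" for s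
  proof -
    have "sin (2 * (s + \<theta> / 2)) = sin (2 * s) * cos \<theta> + cos (2 * s) * sin \<theta>"
      by (simp add: distrib_left sin_add)
    then have "C + 1 * sqrt (C\<^sup>2 - 4) * sin (2 * (s + \<theta> / 2)) = 2 * u_of \<tau> s ^ 2"
      using z_eq[OF that] by (simp add: z_def \<theta> R_def[symmetric] algebra_simps)
    then show ?thesis
      using \<tau>_eq_u_of[of \<tau>, OF pos[OF that]] by simp
  qed
  then have "explicit_form C (\<theta> / 2) \<tau> I"
    unfolding explicit_form_def by blast
  with \<open>C \<ge> 2\<close> show ?thesis
    by blast
qed

lemma stationary_zero_flux_imp_explicit_form:
  assumes I: "open I" "is_interval I" "I \<noteq> {}" and stat: "stationary_on I \<tau>"
    and flux: "\<forall>s\<in>I. flux \<tau> s = 0"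
  shows "\<exists>C\<ge>2. \<exists>k. explicit_form C k \<tau> I"
proof -
  have pos: "\<tau> s > 0" if "s \<in> I" for s
    using stat that by (simp add: stationary_on_def)
  define p where "p = deriv (u_of \<tau>)"
  have u: "(u_of \<tau> has_real_derivative p s) (at s)"
    and p: "(p has_real_derivative 0 - u_of \<tau> s + 1 / u_of \<tau> s ^ 3) (at s)" if "s \<in> I" for s
    using stationary_imp_ode[OF I(1) stat flux that] by (simp_all add: p_def)
  obtain C where C: "\<And>s. s \<in> I \<Longrightarrow> p s ^ 2 = radicand 0 C (u_of \<tau> s)"
    using first_integral[OF I(2) u p u_of_pos[of \<tau>, OF pos]] by blast
  from explicit_form_of_first_integral[OF I u p pos C] show ?thesis
    by blast
qed

text \<open>The point is that the same \<open>C\<close> serves both formulas. The first integral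
  produces some \<open>C'\<close>; comparing the two expressions for \<open>p r ^ 2\<close> at one
  point with positive radicand gives \<open>C' = C\<close>.\<close>

lemma given_by_integral_imp_explicit_form:
  assumes I: "open I" "is_interval I" "I \<noteq> {}" and smooth: "smooth_on I \<tau>"
    and pos: "\<And>s. s \<in> I \<Longrightarrow> \<tau> s > 0" and given: "given_by_integral 0 C \<tau> I"
  shows "C \<ge> 2 \<and> (\<exists>k. explicit_form C k \<tau> I)"
proof -
  have stat: "stationary_on I \<tau>" and flux: "\<forall>s\<in>I. flux \<tau> s = 0"
    using given_by_integral_imp_stationary[OF I(1,3) smooth pos given] by blast+
  define p where "p = deriv (u_of \<tau>)"
  have u: "(u_of \<tau> has_real_derivative p s) (at s)"
    and p: "(p has_real_derivative 0 - u_of \<tau> s + 1 / u_of \<tau> s ^ 3) (at s)" if "s \<in> I" for s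
    using stationary_imp_ode[OF I(1) stat flux that] by (simp_all add: p_def)
  obtain C' where C': "\<And>s. s \<in> I \<Longrightarrow> p s ^ 2 = radicand 0 C' (u_of \<tau> s)"
    using first_integral[OF I(2) u p u_of_pos[of \<tau>, OF pos]] by blast
  have contu: "continuous_on I (u_of \<tau>)"
    using u by (meson DERIV_isCont continuous_at_imp_continuous_on)
  obtain s0 where "s0 \<in> I"
    using I(3) by blast
  then have "\<forall>\<^sub>F r in at s0. r \<in> I \<and> radicand 0 C (u_of \<tau> r) > 0"
    using given eventually_at_in_open'[OF I(1) \<open>s0 \<in> I\<close>]
    unfolding given_by_integral_def by (simp add: eventually_conj)
  from eventually_happens[OF this]
  obtain r where r: "r \<in> I" "radicand 0 C (u_of \<tau> r) > 0"
    by auto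
  obtain J k where J: "open J" "r \<in> J" "J \<subseteq> I" "integral_formula 0 C k \<tau> J"
    using given_by_integral_locally[where \<tau> = \<tau>, OF I(1) pos contu given r] by blast
  obtain \<sigma> where \<sigma>: "\<sigma> \<in> {1, -1}"
    and "\<And>s. s \<in> J \<Longrightarrow> radicand 0 C (u_of \<tau> s) > 0"
    and "\<And>s. s \<in> J \<Longrightarrow> (u_of \<tau> has_real_derivative \<sigma> * sqrt (radicand 0 C (u_of \<tau> s))) (at s)"
    using u_of_derivative_of_integral_formula[OF J(1,4)] by blast
  then have "p r = \<sigma> * sqrt (radicand 0 C (u_of \<tau> r))"
    using DERIV_unique[OF u[OF r(1)]] J(2) by blast
  then have "radicand 0 C (u_of \<tau> r) = radicand 0 C' (u_of \<tau> r)"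
    using C'[OF r(1)] r(2) \<sigma> by (auto simp: power_mult_distrib)
  then have "C' = C"
    by (simp add: radicand_def)
  with explicit_form_of_first_integral[OF I u p pos C'] show ?thesis
    by blast
qed

lemma explicit_form_imp_stationary:
  assumes I: "open I" and "C \<ge> 2" and explicit: "explicit_form C k \<tau> I"
  shows "stationary_on I \<tau>" "\<forall>s\<in>I. flux \<tau> s = 0"
proof -
  obtain \<sigma> where \<sigma>: "\<sigma> \<in> {1, -1}"
    and \<tau>: "\<And>s. s \<in> I \<Longrightarrow> \<tau> s = 2 / (C + \<sigma> * sqrt (C\<^sup>2 - 4) * sin (2 * (s + k)))"
    using explicit unfolding explicit_form_def by blast
  define R where "R = \<sigma> * sqrt (C\<^sup>2 - 4)"
  have "C\<^sup>2 \<ge> 4"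
    using power_mono[OF \<open>C \<ge> 2\<close>, of 2] by simp
  then have R2: "R\<^sup>2 = C\<^sup>2 - 4"
    using \<sigma> by (auto simp: R_def power_mult_distrib)
  \<comment> \<open>This strict inequality keeps the denominator of the explicit formula positive,
    also for \<open>C = 2\<close>, where \<open>R = 0\<close>.\<close>
  then have "\<bar>R\<bar> < C"
    using \<open>C \<ge> 2\<close> by (intro power2_less_imp_less[of "\<bar>R\<bar>" C]) simp_all
  define y where "y s = (C + R * sin (2 * (s + k))) / 2" for s
  define y' where "y' s = R * cos (2 * (s + k))" for s
  have ypos: "y s > 0" for s
  proof -
    have "\<bar>R * sin (2 * (s + k))\<bar> \<le> \<bar>R\<bar> * 1"
      unfolding abs_mult by (intro mult_left_mono) simp_all
    then show ?thesis
      using \<open>\<bar>R\<bar> < C\<close> by (simp add: y_def)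
  qed
  have \<tau>_eq: "\<tau> s = 1 / sqrt (y s) ^ 2" if "s \<in> I" for s
    using \<tau>[OF that] ypos[of s] by (simp add: y_def R_def)
  then have pos: "\<tau> s > 0" if "s \<in> I" for s
    using ypos[of s] that by simp
  have u_eq: "u_of \<tau> s = sqrt (y s)" if "s \<in> I" for s
    using u_of_eq[of "sqrt (y s)" \<tau>, OF _ \<tau>_eq[OF that]] ypos[of s] by simp
  have dy: "(y has_real_derivative y' s) (at s)" for s
    unfolding y_def[abs_def] y'_def by (auto intro!: derivative_eq_intros)
  have dy': "(y' has_real_derivative 2 * C - 4 * y s) (at s)" for s
    unfolding y_def y'_def[abs_def] by (auto intro!: derivative_eq_intros simp: field_simps)
  \<comment> \<open>In terms of \<open>u = sqrt y\<close> this is the first integral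
    \<open>u'\<^sup>2 = radicand 0 C u\<close> multiplied by \<open>4 * y\<close>.\<close>
  have energy: "y' s ^ 2 = 4 * (C * y s - y s ^ 2 - 1)" for s
  proof -
    have "y' s ^ 2 = R\<^sup>2 - (R * sin (2 * (s + k)))\<^sup>2"
      using sin_cos_squared_add[of "2 * (s + k)"] unfolding y'_def by algebra
    also have "R * sin (2 * (s + k)) = 2 * y s - C"
      by (simp add: y_def field_simps)
    finally show ?thesis
      unfolding R2 by algebra
  qed
  define p where "p s = y' s / (2 * sqrt (y s))" for s
  have dsqrt: "((\<lambda>s. sqrt (y s)) has_real_derivative p s) (at s)" for s
    using DERIV_chain2[OF DERIV_real_sqrt[OF ypos] dy] by (simp add: p_def field_simps)
  have u: "(u_of \<tau> has_real_derivative p s) (at s)" if "s \<in> I" for s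
    by (rule has_field_derivative_transform_within_open[OF dsqrt I that]) (simp add: u_eq)
  have p: "(p has_real_derivative 0 - u_of \<tau> s + 1 / u_of \<tau> s ^ 3) (at s)" if "s \<in> I" for s
  proof -
    define v where "v = sqrt (y s)"
    have "v > 0" "y s = v\<^sup>2"
      using ypos[of s] by (simp_all add: v_def)
    have "(p has_real_derivative
        ((2 * C - 4 * y s) * (2 * v) - y' s * (2 * p s)) / (2 * v * (2 * v))) (at s)"
      unfolding p_def[abs_def] v_def
      using DERIV_divide[OF dy' DERIV_cmult[OF dsqrt, of 2], of s] ypos[of s]
      by (simp add: p_def)
    also have "y' s * (2 * p s) = y' s ^ 2 / v"
      by (simp add: p_def v_def power2_eq_square)
    \<comment> \<open>Eliminating \<open>y'\<^sup>2\<close> by the energy identity cancels every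
      term with \<open>C\<close>.\<close>
    also have "((2 * C - 4 * y s) * (2 * v) - y' s ^ 2 / v) / (2 * v * (2 * v)) = 0 - v + 1 / v ^ 3"
      unfolding energy \<open>y s = v\<^sup>2\<close> using \<open>v > 0\<close>
      by (simp add: field_simps power2_eq_square power3_eq_cube)
    finally show ?thesis
      by (simp add: u_eq[OF that] v_def)
  qed
  show "stationary_on I \<tau>" "\<forall>s\<in>I. flux \<tau> s = 0"
    using stationary_onI[OF I u p pos] by blast+
qed

text \<open>The case \<open>A = 0\<close> includes the constant solution \<open>\<tau> = 1\<close>,
  which the explicit formula yields for \<open>C = 2\<close>. The last conjunct adds that the
  constant \<open>C\<close> of the integral formula is also that of the explicit one.\<close>

theorem theorem6:
  fixes I :: "real set" and \<tau> :: "real \<Rightarrow> real"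
  assumes "open I" and "is_interval I" and "I \<noteq> {}"
  shows "(stationary_on I \<tau> \<longrightarrow> (\<exists>A. \<forall>s\<in>I. flux \<tau> s = A)) \<and>
    (\<forall>A. stationary_on I \<tau> \<and> (\<forall>s\<in>I. flux \<tau> s = A) \<and> \<not> \<tau> constant_on I \<longleftrightarrow>
       smooth_on I \<tau> \<and> (\<forall>s\<in>I. \<tau> s > 0) \<and> (\<exists>C. given_by_integral A C \<tau> I)) \<and>
    (\<forall>A C k. (\<forall>s\<in>I. \<tau> s > 0) \<and> integral_formula A C k \<tau> I \<longrightarrow>
       stationary_on I \<tau> \<and> (\<forall>s\<in>I. flux \<tau> s = A) \<and> \<not> \<tau> constant_on I) \<and>
    (stationary_on I \<tau> \<and> (\<forall>s\<in>I. flux \<tau> s = 0) \<longleftrightarrow>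
       (\<exists>C\<ge>2. \<exists>k. explicit_form C k \<tau> I)) \<and>
    (\<forall>C. smooth_on I \<tau> \<and> (\<forall>s\<in>I. \<tau> s > 0) \<and> given_by_integral 0 C \<tau> I \<longrightarrow>
       C \<ge> 2 \<and> (\<exists>k. explicit_form C k \<tau> I))"
proof (intro conjI allI impI iffI; (elim conjE exE)?)
  show "\<exists>A. \<forall>s\<in>I. flux \<tau> s = A" if "stationary_on I \<tau>"
    using stationary_imp_flux_constant[OF assms(2) that] .
next
  fix A assume "stationary_on I \<tau>" "\<forall>s\<in>I. flux \<tau> s = A" "\<not> \<tau> constant_on I"
  then show "smooth_on I \<tau>" "\<forall>s\<in>I. \<tau> s > 0" "\<exists>C. given_by_integral A C \<tau> I"
    using stationary_imp_given_by_integral[OF assms(1,2)] by (auto simp: stationary_on_def)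
next
  fix A C assume "smooth_on I \<tau>" "\<forall>s\<in>I. \<tau> s > 0" "given_by_integral A C \<tau> I"
  then show "stationary_on I \<tau>" "\<forall>s\<in>I. flux \<tau> s = A" "\<not> \<tau> constant_on I"
    using given_by_integral_imp_stationary[OF assms(1,3), of \<tau> A C] by blast+
next
  fix A C k assume "\<forall>s\<in>I. \<tau> s > 0" "integral_formula A C k \<tau> I"
  then show "stationary_on I \<tau>" "\<forall>s\<in>I. flux \<tau> s = A" "\<not> \<tau> constant_on I"
    using integral_formula_imp_stationary[OF assms(1,3), of \<tau> A C k] by blast+
next
  assume "stationary_on I \<tau>" "\<forall>s\<in>I. flux \<tau> s = 0"
  then show "\<exists>C\<ge>2. \<exists>k. explicit_form C k \<tau> I"
    using stationary_zero_flux_imp_explicit_form[OF assms] by blast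
next
  fix C k assume "C \<ge> 2" "explicit_form C k \<tau> I"
  then show "stationary_on I \<tau>" "\<forall>s\<in>I. flux \<tau> s = 0"
    using explicit_form_imp_stationary[OF assms(1)] by blast+
next
  fix C assume "smooth_on I \<tau>" "\<forall>s\<in>I. \<tau> s > 0" "given_by_integral 0 C \<tau> I"
  then show "C \<ge> 2" "\<exists>k. explicit_form C k \<tau> I"
    using given_by_integral_imp_explicit_form[OF assms, of \<tau> C] by blast+
qed

end
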